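(* Let $R$ be an elementary divisor domain and let $f(t),g(t),h(t)\in R[t]$ where $g(t),h(t)$ are monic of positive degree. Then $$(f\circ h)(C_{g\circ h})\sim_S f(C_g)\otimes I_{\deg h(t)}\sim_S I_{\deg h(t)}\otimes f(C_g)=\underbrace{f(C_g)\oplus\cdots\oplus f(C_g)}_{\deg h(t)}.$$
   Context: An elementary divisor domain (EDD) is an integral domain $R$ such that for every matrix $M$ over $R$ there are unimodular matrices $U,V$ with $UMV$ diagonal and each diagonal entry dividing the next. A square matrix over $R$ is unimodular if its determinant is a unit of $R$. For a monic polynomial $g(t)=t^n+\sum_{i=0}^{n-1}g_it^i\in R[t]$, the companion matrix $C_g\in R^{n\times n}$ has first row $(-g_{n-1},\dots,-g_1,-g_0)$, entries $1$ in positions $(i+1,i)$ for $1\le i\le n-1$, and $0$ elsewhere. For $f(t)=\sum_i f_it^i\in R[t]$, $f(C_g)=\sum_i f_iC_g^i$. $(f\circ h)(t)=f(h(t))$ denotes composition of polynomials. Two square matrices $M,N$ over $R$ are similar, $M\sim_S N$, if $UMU^{-1}=N$ for some unimodular $U$ over $R$. $M\otimes N$ is the Kronecker product, i.e. the block matrix whose $(i,j)$ block is $M_{ij}N$; $\oplus$ denotes the block-diagonal direct sum. *)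

theory Defs
  imports "Jordan_Normal_Form.Determinant" "HOL-Computational_Algebra.Polynomial"
begin

definition unimodular :: "'a::comm_ring_1 mat \<Rightarrow> bool" where
  "unimodular U \<longleftrightarrow> square_mat U \<and> det U dvd 1"

(* Rectangular (and empty) matrices are included.  The last clause is the divisibility chain
   along the main diagonal, which has min m n entries. *)
definition elementary_divisor_domain :: "'a::idom itself \<Rightarrow> bool" where
  "elementary_divisor_domain _ \<longleftrightarrow>
    (\<forall>m n. \<forall>M \<in> carrier_mat m n :: 'a mat set.
      \<exists>U \<in> carrier_mat m m. \<exists>V \<in> carrier_mat n n.
        unimodular U \<and> unimodular V \<and> diagonal_mat (U * M * V) \<and>
        (\<forall>i. Suc i < min m n \<longrightarrow> (U * M * V) $$ (i, i) dvd (U * M * V) $$ (Suc i, Suc i)))"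

(* V is the inverse matrix of U. *)
definition unimodular_similar :: "'a::comm_ring_1 mat \<Rightarrow> 'a mat \<Rightarrow> bool"  (infix "\<sim>\<^sub>S" 50) where
  "M \<sim>\<^sub>S N \<longleftrightarrow>
    (\<exists>n. M \<in> carrier_mat n n \<and> N \<in> carrier_mat n n \<and>
      (\<exists>U \<in> carrier_mat n n. \<exists>V \<in> carrier_mat n n.
        unimodular U \<and> inverts_mat U V \<and> inverts_mat V U \<and> U * M * V = N))"

lemma unimodular_similar_iff_similar_mat: "M \<sim>\<^sub>S N \<longleftrightarrow> similar_mat N M"
proof
  assume "M \<sim>\<^sub>S N"
  then obtain n U V where "M \<in> carrier_mat n n" "N \<in> carrier_mat n n"
    "U \<in> carrier_mat n n" "V \<in> carrier_mat n n"
    "inverts_mat U V" "inverts_mat V U" "U * M * V = N"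
    unfolding unimodular_similar_def by blast
  then have "similar_mat_wit N M U V"
    unfolding similar_mat_wit_def inverts_mat_def by (auto simp: Let_def)
  then show "similar_mat N M"
    unfolding similar_mat_def by blast
next
  assume "similar_mat N M"
  then obtain n U V where *: "N \<in> carrier_mat n n" "M \<in> carrier_mat n n"
    "U \<in> carrier_mat n n" "V \<in> carrier_mat n n"
    "U * V = 1\<^sub>m n" "V * U = 1\<^sub>m n" "N = U * M * V"
    using similar_matD by (metis insert_subset)
  have "det U * det V = 1"
    using det_mult[OF *(3,4)] *(5) by simp
  then have "det U dvd 1"
    by (metis dvd_triv_left)
  then have "unimodular U"
    using *(3) by (simp add: unimodular_def)
  moreover have "inverts_mat U V" "inverts_mat V U"
    using * by (simp_all add: inverts_mat_def)
  ultimately show "M \<sim>\<^sub>S N"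
    unfolding unimodular_similar_def using *(1-4,7) by blast
qed

(* Indices start at 0, so that the first row is row 0 and the 1's sit in positions (j + 1, j).
   Meant for monic g. *)
definition companion_mat :: "'a::comm_ring_1 poly \<Rightarrow> 'a mat" where
  "companion_mat g =
    mat (degree g) (degree g)
      (\<lambda>(i, j). if i = 0 then - coeff g (degree g - 1 - j)
               else if i = j + 1 then 1 else 0)"

(* The matrix sum of coeff f i times the i-th power of A over all i, written entrywise because
   'a mat, whose elements have varying dimensions, is not a comm_monoid_add. *)
definition poly_mat :: "'a::comm_ring_1 poly \<Rightarrow> 'a mat \<Rightarrow> 'a mat" where
  "poly_mat f A =
    mat (dim_row A) (dim_row A)
      (\<lambda>rc. \<Sum>i\<le>degree f. (coeff f i \<cdot>\<^sub>m (A ^\<^sub>m i)) $$ rc)"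

definition kronecker_mat :: "'a::comm_ring_1 mat \<Rightarrow> 'a mat \<Rightarrow> 'a mat"  (infixl "\<otimes>\<^sub>K" 70) where
  "M \<otimes>\<^sub>K N =
    mat (dim_row M * dim_row N) (dim_col M * dim_col N)
      (\<lambda>(i, j). M $$ (i div dim_row N, j div dim_col N) * N $$ (i mod dim_row N, j mod dim_col N))"

end

(* The row of p(C_G) with index deg G - 1 lists the coefficients of p modulo G, so it is linear
   in p and vanishes on multiples of G, and the rows of p(C_G) describe multiplication by p
   on R[t]/(G).  For G = g o h, the polynomials h^i t^j with i < deg g and j < deg h have pairwise
   distinct degrees 0, ..., deg G - 1 and leading coefficient 1, so they form another basis of
   R[t]/(G), with unitriangular transition matrix P.  In this basis multiplication by h acts as
   C_g (x) I, that is, P h(C_G) = (C_g (x) I) P; applying f to both sides gives the first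
   similarity.  The two Kronecker products differ by a permutation of the basis. *)
theory Submission
  imports Defs
begin

section \<open>Evaluation of polynomials at a square matrix\<close>

lemma poly_mat_carrier [simp]: "A \<in> carrier_mat n n \<Longrightarrow> poly_mat p A \<in> carrier_mat n n"
  by (simp add: poly_mat_def)

lemma dim_poly_mat [simp]: "dim_row (poly_mat p A) = dim_row A" "dim_col (poly_mat p A) = dim_row A"
  by (simp_all add: poly_mat_def)

lemma companion_mat_carrier [simp]: "companion_mat g \<in> carrier_mat (degree g) (degree g)"
  by (simp add: companion_mat_def)

lemma kronecker_mat_carrier [simp]:
  "A \<in> carrier_mat a b \<Longrightarrow> B \<in> carrier_mat c d \<Longrightarrow> A \<otimes>\<^sub>K B \<in> carrier_mat (a * c) (b * d)"
  by (auto simp: kronecker_mat_def)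

text \<open>The summation bound \<open>d\<close> may exceed the degree, so that polynomials of
  different degrees can be summed over one range.\<close>

lemma poly_mat_index:
  assumes A: "A \<in> carrier_mat n n" and ij: "i < n" "j < n" and d: "degree p \<le> d"
  shows "poly_mat p A $$ (i, j) = (\<Sum>k\<le>d. coeff p k * (A ^\<^sub>m k) $$ (i, j))"
proof -
  have "poly_mat p A $$ (i, j) = (\<Sum>k\<le>degree p. coeff p k * (A ^\<^sub>m k) $$ (i, j))"
    using A ij pow_carrier_mat[OF A] by (auto simp: poly_mat_def intro!: sum.cong)
  also have "\<dots> = (\<Sum>k\<le>d. coeff p k * (A ^\<^sub>m k) $$ (i, j))"
    using d by (intro sum.mono_neutral_left) (auto simp: coeff_eq_0)
  finally show ?thesis .
qed

lemma poly_mat_add: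
  assumes A: "A \<in> carrier_mat n n"
  shows "poly_mat (p + q) A = poly_mat p A + poly_mat q A"
proof (rule eq_matI)
  fix i j assume "i < dim_row (poly_mat p A + poly_mat q A)" "j < dim_col (poly_mat p A + poly_mat q A)"
  then have ij: "i < n" "j < n" using A poly_mat_carrier[OF A, of q] by auto
  let ?d = "max (degree p) (degree q)"
  show "poly_mat (p + q) A $$ (i, j) = (poly_mat p A + poly_mat q A) $$ (i, j)"
    using poly_mat_index[OF A ij, of p ?d] poly_mat_index[OF A ij, of q ?d]
      poly_mat_index[OF A ij, of "p + q" ?d] carrier_matD[OF A] ij
    by (simp add: degree_add_le_max sum.distrib algebra_simps)
qed (use A poly_mat_carrier[OF A] in auto)

lemma poly_mat_smult:
  assumes A: "A \<in> carrier_mat n n"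
  shows "poly_mat (smult c p) A = c \<cdot>\<^sub>m poly_mat p A"
proof (rule eq_matI)
  fix i j assume "i < dim_row (c \<cdot>\<^sub>m poly_mat p A)" "j < dim_col (c \<cdot>\<^sub>m poly_mat p A)"
  then have ij: "i < n" "j < n" using poly_mat_carrier[OF A, of p] by auto
  show "poly_mat (smult c p) A $$ (i, j) = (c \<cdot>\<^sub>m poly_mat p A) $$ (i, j)"
    using poly_mat_index[OF A ij, of p "degree p"]
      poly_mat_index[OF A ij, of "smult c p" "degree p"] carrier_matD[OF A] ij
    by (simp add: degree_smult_le sum_distrib_left algebra_simps)
qed (use poly_mat_carrier[OF A] in auto)

text \<open>Matrix powers recurse by a factor on the right, whereas the Horner form of evaluation
  needs it on the left.\<close>

lemma pow_mat_Suc_left: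
  assumes A: "A \<in> carrier_mat n n"
  shows "A ^\<^sub>m Suc k = A * A ^\<^sub>m k"
proof (induction k)
  case 0
  show ?case using A by simp
next
  case (Suc k)
  have "A ^\<^sub>m Suc (Suc k) = A * A ^\<^sub>m k * A" using Suc by simp
  also have "\<dots> = A * A ^\<^sub>m Suc k"
    using assoc_mult_mat[OF A pow_carrier_mat[OF A] A] by simp
  finally show ?case .
qed

text \<open>Horner step of evaluation. It drives the inductions below on products, compositions,
  intertwining and Kronecker products.\<close>

lemma poly_mat_pCons:
  assumes A: "A \<in> carrier_mat n n"
  shows "poly_mat (pCons a p) A = a \<cdot>\<^sub>m 1\<^sub>m n + A * poly_mat p A"
proof (rule eq_matI)
  fix i j assume "i < dim_row (a \<cdot>\<^sub>m 1\<^sub>m n + A * poly_mat p A)"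
    "j < dim_col (a \<cdot>\<^sub>m 1\<^sub>m n + A * poly_mat p A)"
  then have ij: "i < n" "j < n" using A poly_mat_carrier[OF A, of p] by auto
  note pm = poly_mat_carrier[OF A, of p] and pw = pow_carrier_mat[OF A]
  have "poly_mat (pCons a p) A $$ (i, j)
      = (\<Sum>k\<le>Suc (degree p). coeff (pCons a p) k * (A ^\<^sub>m k) $$ (i, j))"
    using poly_mat_index[OF A ij degree_pCons_le] .
  also have "\<dots> = a * 1\<^sub>m n $$ (i, j) + (\<Sum>k\<le>degree p. coeff p k * (A * A ^\<^sub>m k) $$ (i, j))"
    using A by (simp add: sum.atMost_Suc_shift pow_mat_Suc_left[OF A] del: pow_mat.simps(2) sum.atMost_Suc)
  also have "(\<Sum>k\<le>degree p. coeff p k * (A * A ^\<^sub>m k) $$ (i, j))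
     = (\<Sum>k\<le>degree p. coeff p k * (\<Sum>l<n. A $$ (i, l) * (A ^\<^sub>m k) $$ (l, j)))"
    using A ij pw by (intro sum.cong) (auto simp: scalar_prod_def atLeast0LessThan)
  also have "\<dots> = (\<Sum>l<n. A $$ (i, l) * (\<Sum>k\<le>degree p. coeff p k * (A ^\<^sub>m k) $$ (l, j)))"
    unfolding sum_distrib_left by (subst sum.swap) (simp add: algebra_simps)
  also have "\<dots> = (A * poly_mat p A) $$ (i, j)"
    using A ij pm poly_mat_index[OF A _ ij(2) order_refl, of _ p]
    by (auto simp: scalar_prod_def atLeast0LessThan intro!: sum.cong)
  finally show "poly_mat (pCons a p) A $$ (i, j) = (a \<cdot>\<^sub>m 1\<^sub>m n + A * poly_mat p A) $$ (i, j)"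
    using carrier_matD[OF A] ij by simp
qed (use A poly_mat_carrier[OF A] in auto)

lemma poly_mat_0: "A \<in> carrier_mat n n \<Longrightarrow> poly_mat 0 A = 0\<^sub>m n n"
  using poly_mat_smult[of A n 0 0] by (intro eq_matI) (auto simp: poly_mat_def)

lemma poly_mat_mult:
  assumes A: "A \<in> carrier_mat n n"
  shows "poly_mat (p * q) A = poly_mat p A * poly_mat q A"
proof (induction p)
  case 0
  then show ?case
    using left_mult_zero_mat[OF poly_mat_carrier[OF A, of q]] by (simp add: poly_mat_0[OF A])
next
  case (pCons a p)
  note c = poly_mat_carrier[OF A]
  \<comment> \<open>\<open>mult_pCons_left\<close> yields the polynomial
    \<open>pCons 0 (p * q)\<close>, whose Horner step leaves a zero multiple of the
    identity.\<close>
  have z: "0 \<cdot>\<^sub>m 1\<^sub>m n + M = M" if "M \<in> carrier_mat n n" for M :: "'a mat"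
    using that by (intro eq_matI) auto
  have "poly_mat (pCons a p * q) A = a \<cdot>\<^sub>m poly_mat q A + A * (poly_mat p A * poly_mat q A)"
    using pCons c[of p] c[of q] A
    by (simp add: mult_pCons_left poly_mat_add[OF A] poly_mat_smult[OF A] poly_mat_pCons[OF A]
        z[OF mult_carrier_mat[OF A mult_carrier_mat[OF c c]]])
  also have "\<dots> = (a \<cdot>\<^sub>m 1\<^sub>m n) * poly_mat q A + (A * poly_mat p A) * poly_mat q A"
    using c[of p] c[of q] A by (simp add: assoc_mult_mat[OF A c c] mult_smult_assoc_mat[OF one_carrier_mat c])
  also have "\<dots> = poly_mat (pCons a p) A * poly_mat q A"
    using c[of p] c[of q] A
    by (simp add: poly_mat_pCons[OF A] add_mult_distrib_mat[of _ n n _ _ n])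
  finally show ?case .
qed

text \<open>Composition is itself a Horner recursion in \<open>q\<close>, and evaluation at
  \<open>A\<close> respects sums and products. This turns evaluating \<open>f\<close> composed with
  \<open>h\<close> into evaluating \<open>f\<close> at a matrix.\<close>

lemma poly_mat_pcompose:
  assumes A: "A \<in> carrier_mat n n"
  shows "poly_mat (p \<circ>\<^sub>p q) A = poly_mat p (poly_mat q A)"
proof (induction p)
  case 0
  then show ?case by (simp add: poly_mat_0[OF A] poly_mat_0[OF poly_mat_carrier[OF A]])
next
  case (pCons a p)
  have "poly_mat [:a:] A = a \<cdot>\<^sub>m 1\<^sub>m n"
    using A by (simp add: poly_mat_pCons[OF A] poly_mat_0[OF A])
  then show ?case
    using pCons by (simp add: pcompose_pCons poly_mat_add[OF A] poly_mat_mult[OF A]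
        poly_mat_pCons[OF poly_mat_carrier[OF A]])
qed

section \<open>Intertwining matrices, permutations and similarity\<close>

lemma poly_mat_intertwine:
  assumes A: "A \<in> carrier_mat n n" and B: "B \<in> carrier_mat n n" and P: "P \<in> carrier_mat n n"
    and PA: "P * A = B * P"
  shows "P * poly_mat f A = poly_mat f B * P"
proof (induction f)
  case 0
  then show ?case using P by (simp add: poly_mat_0[OF A] poly_mat_0[OF B])
next
  case (pCons a f)
  note a = poly_mat_carrier[OF A, of f] and b = poly_mat_carrier[OF B, of f]
  have "P * poly_mat (pCons a f) A = P * (a \<cdot>\<^sub>m 1\<^sub>m n) + P * (A * poly_mat f A)"
    using P A a by (simp add: poly_mat_pCons[OF A] mult_add_distrib_mat[of _ n n _ n])
  also have "P * (a \<cdot>\<^sub>m 1\<^sub>m n) = (a \<cdot>\<^sub>m 1\<^sub>m n) * P"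
    using P by (simp add: mult_smult_distrib[OF P one_carrier_mat] mult_smult_assoc_mat[OF one_carrier_mat P])
  also have "P * (A * poly_mat f A) = B * P * poly_mat f A"
    using P A a by (simp add: PA[symmetric] assoc_mult_mat[OF P A a])
  also have "\<dots> = B * poly_mat f B * P"
    using pCons by (simp add: assoc_mult_mat[OF B P a] assoc_mult_mat[OF B b P])
  also have "a \<cdot>\<^sub>m 1\<^sub>m n * P + B * poly_mat f B * P = poly_mat (pCons a f) B * P"
    using P B b by (simp add: poly_mat_pCons[OF B] add_mult_distrib_mat[of _ n n _ _ n])
  finally show ?case .
qed

text \<open>Since \<open>det P = 1\<close>, the adjugate of \<open>P\<close> is its inverse, and the
  intertwining relation becomes a conjugation.\<close>

lemma unimodular_similarI:
  assumes A: "A \<in> carrier_mat n n" and B: "B \<in> carrier_mat n n" and P: "P \<in> carrier_mat n n"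
    and det: "det P = 1" and PA: "P * A = B * P"
  shows "A \<sim>\<^sub>S B"
proof -
  let ?V = "adj_mat P"
  have V: "?V \<in> carrier_mat n n" and PV: "P * ?V = 1\<^sub>m n" "?V * P = 1\<^sub>m n"
    using adj_mat[OF P] det by auto
  have "P * A * ?V = B * (P * ?V)"
    using PA by (simp add: assoc_mult_mat[OF B P V])
  then have "P * A * ?V = B" using PV B by simp
  moreover have "unimodular P" using P det by (simp add: unimodular_def)
  ultimately show ?thesis
    unfolding unimodular_similar_def inverts_mat_def
    using A B P V PV by (metis carrier_matD(1))
qed

lemma unimodular_similar_permute:
  assumes A: "A \<in> carrier_mat n n" and bij: "bij_betw \<pi> {..<n} {..<n}"
  shows "A \<sim>\<^sub>S mat n n (\<lambda>(i, j). A $$ (\<pi> i, \<pi> j))"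
proof -
  let ?B = "mat n n (\<lambda>(i, j). A $$ (\<pi> i, \<pi> j))"
  \<comment> \<open>\<open>?U\<close> and its transpose \<open>?V\<close> are permutation matrices:
    the former, on the left, moves row \<open>\<pi> i\<close> to row \<open>i\<close>, and the
    latter, on the right, moves column \<open>\<pi> j\<close> to column \<open>j\<close>.\<close>
  let ?U = "mat n n (\<lambda>(i, j). if j = \<pi> i then 1 else 0) :: 'a mat"
  let ?V = "mat n n (\<lambda>(i, j). if i = \<pi> j then 1 else 0) :: 'a mat"
  have lt: "\<pi> i < n" if "i < n" for i using bij that by (auto simp: bij_betw_def)
  have inj: "\<pi> i = \<pi> j \<longleftrightarrow> i = j" if "i < n" "j < n" for i j
    using bij that by (auto simp: bij_betw_def inj_on_def)
  have UM: "(?U * M) $$ (i, j) = M $$ (\<pi> i, j)"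
    if "M \<in> carrier_mat n n" "i < n" "j < n" for M i j
    using that lt by (auto simp: scalar_prod_def if_distrib[of "\<lambda>x. x * _"] cong: if_cong)
  have MV: "(M * ?V) $$ (i, j) = M $$ (i, \<pi> j)"
    if "M \<in> carrier_mat n n" "i < n" "j < n" for M i j
    using that lt by (auto simp: scalar_prod_def if_distrib[of "\<lambda>x. _ * x"] cong: if_cong)
  have UV: "?U * ?V = 1\<^sub>m n"
    by (rule eq_matI) (auto simp: UM inj lt simp del: index_mult_mat(1))
  \<comment> \<open>For \<open>?U * ?V\<close> injectivity of \<open>\<pi>\<close> was enough. In
    this order its surjectivity supplies the only index \<open>k\<close> that can contribute to row
    \<open>i\<close>.\<close>
  have VU: "?V * ?U = 1\<^sub>m n"
  proof (rule eq_matI)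
    fix i j assume "i < dim_row (1\<^sub>m n :: 'a mat)" "j < dim_col (1\<^sub>m n :: 'a mat)"
    then have ij: "i < n" "j < n" by auto
    then obtain k where k: "k < n" "\<pi> k = i"
      using bij by (metis bij_betw_iff_bijections lessThan_iff)
    have "(?V * ?U) $$ (i, j) = (\<Sum>l<n. if l = k then if j = i then 1 else 0 else 0)"
    proof -
      have "(?V * ?U) $$ (i, j)
        = (\<Sum>l<n. (if i = \<pi> l then 1 else 0) * (if j = \<pi> l then 1 else 0))"
        using ij by (simp add: scalar_prod_def atLeast0LessThan)
      also have "\<dots> = (\<Sum>l<n. if l = k then if j = i then 1 else 0 else 0)"
        using k inj[of k] by (intro sum.cong) auto
      finally show ?thesis .
    qed
    then show "(?V * ?U) $$ (i, j) = 1\<^sub>m n $$ (i, j)" using ij k by simp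
  qed auto
  have "?U * A * ?V = ?B"
    using A by (intro eq_matI) (auto simp: MV[OF mult_carrier_mat[OF mat_carrier A]] UM[OF A] lt simp del: index_mult_mat(1))
  then have "similar_mat_wit ?B A ?U ?V"
    using A UV VU by (auto simp: similar_mat_wit_def Let_def)
  then show ?thesis
    unfolding unimodular_similar_iff_similar_mat similar_mat_def by blast
qed

section \<open>Kronecker products with an identity factor\<close>

lemma sum_residue_class:
  fixes F :: "nat \<Rightarrow> 'b::comm_monoid_add"
  assumes "b < m"
  shows "(\<Sum>l<n * m. if l mod m = b then F l else 0) = (\<Sum>c<n. F (c * m + b))"
proof -
  have "(\<Sum>l<n * m. if l mod m = b then F l else 0) = sum F {l \<in> {..<n * m}. l mod m = b}"
    by (subst sum.inter_filter) auto
  also have "\<dots> = (\<Sum>c<n. F (c * m + b))"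
  proof (rule sum.reindex_bij_witness[of _ "\<lambda>c. c * m + b" "\<lambda>l. l div m"])
    fix c assume "c \<in> {..<n}"
    then have "Suc c * m \<le> n * m" by (intro mult_le_mono1) auto
    then show "c * m + b \<in> {l \<in> {..<n * m}. l mod m = b}" using assms by auto
  qed (use assms in \<open>auto simp: less_mult_imp_div_less div_mult_mod_eq\<close>)
  finally show ?thesis .
qed

lemma kronecker_one_index:
  assumes "A \<in> carrier_mat n n" "i < n * m" "j < n * m"
  shows "(A \<otimes>\<^sub>K 1\<^sub>m m) $$ (i, j) = (if i mod m = j mod m then A $$ (i div m, j div m) else 0)"
proof -
  have "m > 0" using assms(2) by (cases m) auto
  then show ?thesis using assms by (auto simp: kronecker_mat_def)
qed

text \<open>The identity factor keeps only the summation indices congruent to \<open>i\<close>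
  modulo \<open>m\<close>, one in each of the \<open>n\<close> blocks. \<open>B\<close> is arbitrary
  because the formula is also applied to a transition matrix that is no Kronecker product.\<close>

lemma kronecker_one_mult_index:
  assumes A: "A \<in> carrier_mat n n" and B: "B \<in> carrier_mat (n * m) (n * m)"
    and i: "i < n * m" and j: "j < n * m"
  shows "((A \<otimes>\<^sub>K 1\<^sub>m m) * B) $$ (i, j)
    = (\<Sum>c<n. A $$ (i div m, c) * B $$ (c * m + i mod m, j))"
proof -
  have m: "i mod m < m" using i by (cases m) auto
  have "((A \<otimes>\<^sub>K 1\<^sub>m m) * B) $$ (i, j) = (\<Sum>l<n * m. (A \<otimes>\<^sub>K 1\<^sub>m m) $$ (i, l) * B $$ (l, j))"
    using kronecker_mat_carrier[OF A one_carrier_mat[of m]] B i j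
    by (simp add: scalar_prod_def atLeast0LessThan)
  also have "\<dots> = (\<Sum>l<n * m. if l mod m = i mod m then A $$ (i div m, l div m) * B $$ (l, j) else 0)"
    using kronecker_one_index[OF A i] by (intro sum.cong) auto
  also have "\<dots> = (\<Sum>c<n. A $$ (i div m, c) * B $$ (c * m + i mod m, j))"
    using m by (subst sum_residue_class) auto
  finally show ?thesis .
qed

lemma kronecker_one_mult:
  assumes A: "A \<in> carrier_mat n n" and B: "B \<in> carrier_mat n n"
  shows "(A \<otimes>\<^sub>K 1\<^sub>m m) * (B \<otimes>\<^sub>K 1\<^sub>m m) = (A * B) \<otimes>\<^sub>K 1\<^sub>m m"
proof (rule eq_matI)
  note AK = kronecker_mat_carrier[OF A one_carrier_mat[of m]]
    and BK = kronecker_mat_carrier[OF B one_carrier_mat[of m]]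
    and ABK = kronecker_mat_carrier[OF mult_carrier_mat[OF A B] one_carrier_mat[of m]]
  fix i j assume "i < dim_row ((A * B) \<otimes>\<^sub>K 1\<^sub>m m)" "j < dim_col ((A * B) \<otimes>\<^sub>K 1\<^sub>m m)"
  then have ij: "i < n * m" "j < n * m" using ABK by (auto simp del: kronecker_mat_carrier)
  have m: "i mod m < m" using ij by (cases m) auto
  have lt: "c * m + i mod m < n * m" if "c < n" for c
  proof -
    have "Suc c * m \<le> n * m" using that by (intro mult_le_mono1) auto
    then show ?thesis using m by auto
  qed
  have "((A \<otimes>\<^sub>K 1\<^sub>m m) * (B \<otimes>\<^sub>K 1\<^sub>m m)) $$ (i, j)
    = (\<Sum>c<n. A $$ (i div m, c) * (B \<otimes>\<^sub>K 1\<^sub>m m) $$ (c * m + i mod m, j))"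
    by (rule kronecker_one_mult_index[OF A BK ij])
  also have "\<dots> = (\<Sum>c<n. A $$ (i div m, c) * (if i mod m = j mod m then B $$ (c, j div m) else 0))"
    using m by (intro sum.cong refl) (auto simp: kronecker_one_index[OF B lt ij(2)])
  also have "\<dots> = ((A * B) \<otimes>\<^sub>K 1\<^sub>m m) $$ (i, j)"
    using A B ij less_mult_imp_div_less[OF ij(1)] less_mult_imp_div_less[OF ij(2)]
    by (auto simp: kronecker_one_index[OF mult_carrier_mat[OF A B] ij] scalar_prod_def
        atLeast0LessThan)
  finally show "((A \<otimes>\<^sub>K 1\<^sub>m m) * (B \<otimes>\<^sub>K 1\<^sub>m m)) $$ (i, j) = ((A * B) \<otimes>\<^sub>K 1\<^sub>m m) $$ (i, j)" .
qed (use A B in \<open>auto simp: kronecker_mat_def\<close>)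

text \<open>Taking the Kronecker product with an identity on the right respects sums, products,
  scalar multiples and the identity matrix, hence polynomial evaluation.\<close>

lemma poly_mat_kronecker_one:
  assumes A: "A \<in> carrier_mat n n"
  shows "poly_mat f (A \<otimes>\<^sub>K 1\<^sub>m m) = poly_mat f A \<otimes>\<^sub>K 1\<^sub>m m"
proof (induction f)
  case 0
  note AK = kronecker_mat_carrier[OF A one_carrier_mat[of m]]
  show ?case
    unfolding poly_mat_0[OF A] poly_mat_0[OF AK]
    by (rule eq_matI) (auto simp: kronecker_mat_def less_mult_imp_div_less)
next
  case (pCons a f)
  note AK = kronecker_mat_carrier[OF A one_carrier_mat[of m]]
    and AF = mult_carrier_mat[OF A poly_mat_carrier[OF A, of f]]
  have "poly_mat (pCons a f) (A \<otimes>\<^sub>K 1\<^sub>m m)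
    = a \<cdot>\<^sub>m 1\<^sub>m (n * m) + (A * poly_mat f A) \<otimes>\<^sub>K 1\<^sub>m m"
    using pCons by (simp add: poly_mat_pCons[OF AK] kronecker_one_mult[OF A poly_mat_carrier[OF A]])
  also have "\<dots> = (a \<cdot>\<^sub>m 1\<^sub>m n + A * poly_mat f A) \<otimes>\<^sub>K 1\<^sub>m m"
  proof (rule eq_matI)
    fix i j assume "i < dim_row ((a \<cdot>\<^sub>m 1\<^sub>m n + A * poly_mat f A) \<otimes>\<^sub>K 1\<^sub>m m)"
      "j < dim_col ((a \<cdot>\<^sub>m 1\<^sub>m n + A * poly_mat f A) \<otimes>\<^sub>K 1\<^sub>m m)"
    then have ij: "i < n * m" "j < n * m"
      using AF A by (auto simp: kronecker_mat_def poly_mat_def)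
    have d: "i div m < n" "j div m < n" using ij by (simp_all add: less_mult_imp_div_less)
    \<comment> \<open>Equality of indices splits into equality of block and of offset: the identity
      of size \<open>n * m\<close> is the Kronecker product of the identities of sizes
      \<open>n\<close> and \<open>m\<close>.\<close>
    have eq: "i = j \<longleftrightarrow> i div m = j div m \<and> i mod m = j mod m"
      by (metis div_mult_mod_eq)
    have S: "a \<cdot>\<^sub>m 1\<^sub>m n + A * poly_mat f A \<in> carrier_mat n n" using AF by auto
    have "((A * poly_mat f A) \<otimes>\<^sub>K 1\<^sub>m m) $$ (i, j)
       = (if i mod m = j mod m then (A * poly_mat f A) $$ (i div m, j div m) else 0)"
      by (rule kronecker_one_index[OF AF ij])
    moreover have "((a \<cdot>\<^sub>m 1\<^sub>m n + A * poly_mat f A) \<otimes>\<^sub>K 1\<^sub>m m) $$ (i, j)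
       = (if i mod m = j mod m then (a \<cdot>\<^sub>m 1\<^sub>m n + A * poly_mat f A) $$ (i div m, j div m) else 0)"
      by (rule kronecker_one_index[OF S ij])
    moreover have "(a \<cdot>\<^sub>m 1\<^sub>m n + A * poly_mat f A) $$ (i div m, j div m)
       = (if i div m = j div m then a else 0) + (A * poly_mat f A) $$ (i div m, j div m)"
      using d AF by (auto simp del: index_mult_mat(1))
    moreover have "(a \<cdot>\<^sub>m 1\<^sub>m (n * m) + (A * poly_mat f A) \<otimes>\<^sub>K 1\<^sub>m m) $$ (i, j)
       = (if i = j then a else 0) + ((A * poly_mat f A) \<otimes>\<^sub>K 1\<^sub>m m) $$ (i, j)"
      using ij kronecker_mat_carrier[OF AF one_carrier_mat[of m]]
      by (auto simp del: index_mult_mat(1) kronecker_mat_carrier)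
    ultimately show "(a \<cdot>\<^sub>m 1\<^sub>m (n * m) + (A * poly_mat f A) \<otimes>\<^sub>K 1\<^sub>m m) $$ (i, j)
      = ((a \<cdot>\<^sub>m 1\<^sub>m n + A * poly_mat f A) \<otimes>\<^sub>K 1\<^sub>m m) $$ (i, j)"
      using eq by (auto simp del: index_mult_mat(1))
  qed (use A in \<open>auto simp: kronecker_mat_def poly_mat_def\<close>)
  finally show ?case by (simp add: poly_mat_pCons[OF A])
qed

lemma kronecker_one_commute:
  assumes A: "A \<in> carrier_mat n n"
  shows "A \<otimes>\<^sub>K 1\<^sub>m m \<sim>\<^sub>S 1\<^sub>m m \<otimes>\<^sub>K A"
proof -
  \<comment> \<open>A pair \<open>(a, b)\<close> with \<open>a < n\<close> and \<open>b < m\<close>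
    has index \<open>a * m + b\<close> in the first product and \<open>b * n + a\<close> in the
    second. \<open>\<pi>\<close> translates the second index into the first, and
    \<open>\<rho>\<close> goes back.\<close>
  define \<pi> where "\<pi> i = (i mod n) * m + i div n" for i
  define \<rho> where "\<rho> i = (i mod m) * n + i div m" for i
  have bnd: "x * b + y < a * b" if "x < a" "y < b" for x y a b :: nat
  proof -
    have "Suc x * b \<le> a * b" using that by (intro mult_le_mono1) auto
    then show ?thesis using that by auto
  qed
  have facts: "i mod n < n" "i div n < m" "i mod m < m" "i div m < n" if "i < n * m" for i
    using that less_mult_imp_div_less[of i n m] less_mult_imp_div_less[of i m n]
    by (auto simp: mult.commute intro!: mod_less_divisor gr0I)
  have dm: "\<pi> i div m = i mod n" "\<pi> i mod m = i div n"
    and dm': "\<rho> i div n = i mod m" "\<rho> i mod n = i div m" if "i < n * m" for i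
  proof -
    have "n > 0" "m > 0" using that by (auto intro!: gr0I)
    then show "\<pi> i div m = i mod n" "\<pi> i mod m = i div n"
      "\<rho> i div n = i mod m" "\<rho> i mod n = i div m"
      using facts[OF that] by (simp_all add: \<pi>_def \<rho>_def)
  qed
  have bij: "bij_betw \<pi> {..<n * m} {..<n * m}"
  proof (rule bij_betw_byWitness[where f' = \<rho>])
    show "\<forall>i\<in>{..<n * m}. \<rho> (\<pi> i) = i" by (auto simp: \<rho>_def[of "\<pi> _"] dm)
    show "\<forall>i\<in>{..<n * m}. \<pi> (\<rho> i) = i" by (auto simp: \<pi>_def[of "\<rho> _"] dm')
    show "\<pi> ` {..<n * m} \<subseteq> {..<n * m}" using facts bnd by (auto simp: \<pi>_def)
    show "\<rho> ` {..<n * m} \<subseteq> {..<n * m}"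
      using facts bnd[of _ m _ n] by (auto simp: \<rho>_def mult.commute[of n m])
  qed
  have lt: "\<pi> i < n * m" if "i < n * m" for i using bij that by (auto simp: bij_betw_def)
  have "1\<^sub>m m \<otimes>\<^sub>K A = mat (n * m) (n * m) (\<lambda>(i, j). (A \<otimes>\<^sub>K 1\<^sub>m m) $$ (\<pi> i, \<pi> j))"
    using A facts
    by (intro eq_matI) (auto simp: kronecker_one_index[OF A lt lt] dm, auto simp: kronecker_mat_def mult.commute)
  then show ?thesis
    using unimodular_similar_permute[OF kronecker_mat_carrier[OF A one_carrier_mat] bij] by simp
qed

lemma one_kronecker_eq_diag_block_mat:
  assumes A: "A \<in> carrier_mat n n"
  shows "1\<^sub>m m \<otimes>\<^sub>K A = diag_block_mat (replicate m A)"
proof (induction m)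
  case 0
  then show ?case by (auto simp: kronecker_mat_def)
next
  case (Suc m)
  have dims: "dim_row (1\<^sub>m m \<otimes>\<^sub>K A) = m * n" "dim_col (1\<^sub>m m \<otimes>\<^sub>K A) = m * n"
    using A by (auto simp: kronecker_mat_def)
  \<comment> \<open>\<open>diag_block_mat\<close> splits off its first block at the top left, so the
    Kronecker product is cut there as well.\<close>
  have "1\<^sub>m (Suc m) \<otimes>\<^sub>K A = four_block_mat A (0\<^sub>m n (m * n)) (0\<^sub>m (m * n) n) (1\<^sub>m m \<otimes>\<^sub>K A)"
  proof (rule eq_matI)
    fix i j assume "i < dim_row (four_block_mat A (0\<^sub>m n (m * n)) (0\<^sub>m (m * n) n) (1\<^sub>m m \<otimes>\<^sub>K A))"
      "j < dim_col (four_block_mat A (0\<^sub>m n (m * n)) (0\<^sub>m (m * n) n) (1\<^sub>m m \<otimes>\<^sub>K A))"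
    then have ij: "i < n + m * n" "j < n + m * n" using A dims by auto
    have n: "n > 0" using ij by (cases n) auto
    have d: "k div n < Suc m" if "k < n + m * n" for k
      using that by (intro less_mult_imp_div_less) simp
    \<comment> \<open>Past the first block, shifting an index by \<open>n\<close> lowers the block
      number by one and keeps the offset.\<close>
    have e: "k div n = Suc ((k - n) div n)" "k mod n = (k - n) mod n" if "\<not> k < n" for k
      using that n by (simp_all add: le_div_geq le_mod_geq)
    have lt: "(k - n) div n < m" if "\<not> k < n" "k < n + m * n" for k
      using that by (intro less_mult_imp_div_less) linarith
    show "(1\<^sub>m (Suc m) \<otimes>\<^sub>K A) $$ (i, j)
      = four_block_mat A (0\<^sub>m n (m * n)) (0\<^sub>m (m * n) n) (1\<^sub>m m \<otimes>\<^sub>K A) $$ (i, j)"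
      using A ij dims d[OF ij(1)] d[OF ij(2)] lt[of i] lt[of j] e[of i] e[of j]
      by (auto simp: kronecker_mat_def)
  qed (use A dims in \<open>auto simp: kronecker_mat_def\<close>)
  then show ?case using A Suc dims by (simp add: Let_def)
qed

section \<open>Companion matrices and their action on coordinate rows\<close>

lemma companion_mat_pow_last_row:
  assumes "k < degree g" "j < degree g"
  shows "(companion_mat g ^\<^sub>m k) $$ (degree g - 1, j) = (if j = degree g - 1 - k then 1 else 0)"
  using assms
proof (induction k arbitrary: j)
  case 0
  then show ?case by (auto simp: companion_mat_def)
next
  case (Suc k)
  note C = companion_mat_carrier[of g]
  have "(companion_mat g ^\<^sub>m Suc k) $$ (degree g - 1, j)
    = (\<Sum>l<degree g. (companion_mat g ^\<^sub>m k) $$ (degree g - 1, l) * companion_mat g $$ (l, j))"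
    using Suc.prems carrier_matD[OF C] carrier_matD[OF pow_carrier_mat[OF C, of k]] by (simp add: scalar_prod_def atLeast0LessThan)
  also have "\<dots> = (\<Sum>l<degree g. if l = degree g - 1 - k then companion_mat g $$ (l, j) else 0)"
    using Suc by (intro sum.cong) auto
  also have "\<dots> = companion_mat g $$ (degree g - 1 - k, j)" using Suc.prems by simp
  \<comment> \<open>The row index \<open>degree g - 1 - k\<close> is still positive, so this row of
    the companion matrix is the unit vector one position further to the left.\<close>
  also have "\<dots> = (if j = degree g - 1 - Suc k then 1 else 0)"
    using Suc.prems by (auto simp: companion_mat_def)
  finally show ?case .
qed

text \<open>The last rows of the powers are unit vectors moving from right to left, so their
  combination lists the coefficients from the highest power down.\<close>

lemma poly_mat_companion_last_row:
  assumes p: "degree p < degree g" and j: "j < degree g"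
  shows "poly_mat p (companion_mat g) $$ (degree g - 1, j) = coeff p (degree g - 1 - j)"
proof -
  have "poly_mat p (companion_mat g) $$ (degree g - 1, j)
    = (\<Sum>k\<le>degree g - 1. coeff p k * (companion_mat g ^\<^sub>m k) $$ (degree g - 1, j))"
    using p j by (intro poly_mat_index[OF companion_mat_carrier]) auto
  also have "\<dots> = (\<Sum>k\<le>degree g - 1. if k = degree g - 1 - j then coeff p k else 0)"
    using j by (intro sum.cong) (auto simp: companion_mat_pow_last_row[simplified])
  finally show ?thesis by simp
qed

text \<open>The part of the Cayley-Hamilton theorem that is needed: the last row only.\<close>

lemma poly_mat_companion_self_last_row:
  assumes g: "lead_coeff g = 1" and j: "j < degree g"
  shows "poly_mat g (companion_mat g) $$ (degree g - 1, j) = 0"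
proof -
  note C = companion_mat_carrier[of g]
  obtain d where d: "degree g = Suc d" using j by (cases "degree g") auto
  have "poly_mat g (companion_mat g) $$ (d, j)
    = (\<Sum>k\<le>Suc d. coeff g k * (companion_mat g ^\<^sub>m k) $$ (d, j))"
    using j d by (intro poly_mat_index[OF companion_mat_carrier]) auto
  also have "\<dots> = (\<Sum>k\<le>d. coeff g k * (companion_mat g ^\<^sub>m k) $$ (d, j))
      + (companion_mat g ^\<^sub>m Suc d) $$ (d, j)"
    using g d by simp
  also have "(\<Sum>k\<le>d. coeff g k * (companion_mat g ^\<^sub>m k) $$ (d, j))
    = (\<Sum>k\<le>d. if k = d - j then coeff g k else 0)"
    using j d companion_mat_pow_last_row[of _ g j] by (intro sum.cong) auto
  also have "\<dots> = coeff g (d - j)" by simp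
  \<comment> \<open>This power is one beyond the range where the last row is a unit vector. The last
    row of the \<open>d\<close>-th power is the unit vector at 0, so one more factor gives row 0 of
    the companion matrix, which cancels the lower terms.\<close>
  also have "(companion_mat g ^\<^sub>m Suc d) $$ (d, j)
    = (\<Sum>l<Suc d. (companion_mat g ^\<^sub>m d) $$ (d, l) * companion_mat g $$ (l, j))"
    using j d C pow_carrier_mat[OF C, of d]
    by (simp add: scalar_prod_def atLeast0LessThan del: sum.lessThan_Suc)
  also have "\<dots> = (\<Sum>l<Suc d. if l = 0 then companion_mat g $$ (l, j) else 0)"
    using d companion_mat_pow_last_row[of d g] by (intro sum.cong) auto
  also have "\<dots> = - coeff g (d - j)" using d j by (simp add: companion_mat_def del: sum.lessThan_Suc)
  finally show ?thesis using d by simp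
qed

text \<open>On the descending powers of \<open>h\<close>, the companion matrix of \<open>g\<close>
  acts as multiplication by \<open>h\<close>. The rows below the first merely shift; the first
  rewrites the top power by means of \<open>g\<close>, which is exact up to the composition of
  \<open>g\<close> with \<open>h\<close>.\<close>

lemma sum_companion_mat_row:
  assumes g: "lead_coeff g = 1" and a: "a < degree g"
  shows "(\<Sum>c<degree g. smult (companion_mat g $$ (a, c)) (h ^ (degree g - 1 - c)))
    = h ^ (degree g - a) - (if a = 0 then g \<circ>\<^sub>p h else 0)"
proof (cases "a = 0")
  case True
  have "g \<circ>\<^sub>p h = (\<Sum>k\<le>degree g. smult (coeff g k) (h ^ k))"
    by (simp add: pcompose_altdef poly_altdef coeff_map_poly degree_map_poly)
  also have "\<dots> = (\<Sum>k<degree g. smult (coeff g k) (h ^ k)) + h ^ degree g"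
    using g by (simp add: lessThan_Suc_atMost[symmetric])
  also have "(\<Sum>k<degree g. smult (coeff g k) (h ^ k))
    = (\<Sum>c<degree g. smult (coeff g (degree g - 1 - c)) (h ^ (degree g - 1 - c)))"
    using sum.nat_diff_reindex[of "\<lambda>k. smult (coeff g k) (h ^ k)" "degree g"] by simp
  finally show ?thesis using True a by (simp add: companion_mat_def sum_negf)
next
  case False
  have "(\<Sum>c<degree g. smult (companion_mat g $$ (a, c)) (h ^ (degree g - 1 - c)))
    = (\<Sum>c<degree g. if c = a - 1 then h ^ (degree g - 1 - c) else 0)"
    using False a by (intro sum.cong) (auto simp: companion_mat_def)
  also have "\<dots> = h ^ (degree g - a)" using False a by simp
  finally show ?thesis using False by simp
qed

section \<open>The transition matrix for a composition\<close>

theorem companion_mat_pcompose: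
  fixes g h :: "'a::idom poly"
  assumes g: "lead_coeff g = 1" and h: "lead_coeff h = 1"
    and dg: "degree g > 0" and dh: "degree h > 0"
  obtains P where "P \<in> carrier_mat (degree g * degree h) (degree g * degree h)" "det P = 1"
    "P * poly_mat h (companion_mat (g \<circ>\<^sub>p h)) = (companion_mat g \<otimes>\<^sub>K 1\<^sub>m (degree h)) * P"
proof -
  define n m N G where "n = degree g" and "m = degree h" and "N = n * m" and "G = g \<circ>\<^sub>p h"
  define C where "C = companion_mat G"
  \<comment> \<open>\<open>\<phi> j p\<close> is the coefficient of \<open>p\<close> modulo
    \<open>G\<close> at exponent \<open>N - 1 - j\<close>.\<close>
  define \<phi> where "\<phi> j p = poly_mat p C $$ (N - 1, j)" for j p
  \<comment> \<open>The new basis is listed by descending degree, like the monomials in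
    \<open>\<phi>\<close>: \<open>u k\<close> has degree \<open>N - 1 - k\<close>, with the power of
    \<open>h\<close> determined by the block of \<open>k\<close> and the power of the variable by
    the offset.\<close>
  define v where "v b c = h ^ (n - 1 - c) * monom 1 (m - 1 - b)" for b c
  define u where "u k = v (k mod m) (k div m)" for k
  define P where "P = mat N N (\<lambda>(k, j). \<phi> j (u k))"
  have n: "n > 0" and m: "m > 0" and N: "N > 0" using dg dh by (auto simp: n_def m_def N_def)
  have dG: "degree G = N" by (simp add: G_def N_def n_def m_def degree_pcompose)
  have G: "lead_coeff G = 1"
    using g h dh by (simp add: G_def lead_coeff_comp)
  have C: "C \<in> carrier_mat N N" using companion_mat_carrier[of G] by (simp add: C_def dG)
  have P: "P \<in> carrier_mat N N" by (simp add: P_def)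
  have \<phi>_coeff: "\<phi> j p = coeff p (N - 1 - j)" if "degree p < N" "j < N" for j p
    using poly_mat_companion_last_row[of p G j] that by (simp add: \<phi>_def C_def dG)
  \<comment> \<open>The last row of a product of matrices is the last row of the first factor times
    the second: multiplication by \<open>q\<close> acts on coordinate rows as
    \<open>poly_mat q C\<close>.\<close>
  have \<phi>_mult: "\<phi> j (p * q) = (\<Sum>l<N. \<phi> l p * poly_mat q C $$ (l, j))" if "j < N" for j p q
    using that N C poly_mat_carrier[OF C]
    by (simp add: \<phi>_def poly_mat_mult[OF C] scalar_prod_def atLeast0LessThan)
  have \<phi>_G: "\<phi> j (G * q) = 0" if "j < N" for j q
    using poly_mat_companion_self_last_row[OF G]
    by (simp add: \<phi>_mult[OF that]) (simp add: \<phi>_def C_def dG)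
  have \<phi>_add: "\<phi> j (p + q) = \<phi> j p + \<phi> j q" if "j < N" for j p q
    using that N C poly_mat_carrier[OF C] by (simp add: \<phi>_def poly_mat_add[OF C])
  have \<phi>_smult: "\<phi> j (smult c p) = c * \<phi> j p" if "j < N" for j c p
    using that N C poly_mat_carrier[OF C] by (simp add: \<phi>_def poly_mat_smult[OF C])
  have \<phi>_sum: "\<phi> j (\<Sum>i\<in>I. f i) = (\<Sum>i\<in>I. \<phi> j (f i))" if "j < N" for j I and f :: "nat \<Rightarrow> 'a poly"
    using that N poly_mat_0[OF C]
    by (induction I rule: infinite_finite_induct) (simp_all add: \<phi>_add, simp_all add: \<phi>_def)
  have lt: "c * m + b < N" if "c < n" "b < m" for b c
  proof -
    have "Suc c * m \<le> N" unfolding N_def using that by (intro mult_le_mono1) auto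
    then show ?thesis using that by auto
  qed
  have du: "degree (u k) = N - 1 - k" and lu: "lead_coeff (u k) = 1" if k: "k < N" for k
  proof -
    have h0: "h \<noteq> 0" using h by auto
    have km: "k div m < n" "k mod m < m" using k m by (auto simp: N_def less_mult_imp_div_less)
    have "degree (u k) = (n - 1 - k div m) * m + (m - 1 - k mod m)"
      using h0 by (simp add: u_def v_def degree_mult_eq degree_power_eq degree_monom_eq m_def)
    \<comment> \<open>The exponents complement the block of \<open>k\<close> to \<open>n - 1\<close>
      and its offset to \<open>m - 1\<close>, and complementing both digits of \<open>k\<close>
      complements \<open>k\<close> to \<open>N - 1\<close>.\<close>
    also have "\<dots> = N - 1 - (k div m * m + k mod m)"
    proof -
      obtain x y where "n = Suc (k div m + x)" "m = Suc (k mod m + y)"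
        using km by (metis less_iff_Suc_add)
      then obtain x y where xy: "n - 1 - k div m = x" "m - 1 - k mod m = y"
         "n = k div m + x + 1" "m = k mod m + y + 1" by auto
      have "N = (k div m) * m + x * m + m" unfolding N_def by (subst xy(3)) (simp add: algebra_simps)
      then show ?thesis unfolding xy(1,2) using xy(4) by linarith
    qed
    finally show "degree (u k) = N - 1 - k" by simp
    show "lead_coeff (u k) = 1"
      using h by (simp add: u_def v_def lead_coeff_mult lead_coeff_power degree_monom_eq)
  qed
  have P_index: "P $$ (k, j) = coeff (u k) (N - 1 - j)" if "k < N" "j < N" for k j
    using that du[of k] by (simp add: P_def \<phi>_coeff)
  \<comment> \<open>Below the diagonal, where \<open>j < k\<close>, the exponent
    \<open>N - 1 - j\<close> exceeds the degree of \<open>u k\<close>; on the diagonal it equals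
    that degree and picks the leading coefficient 1.\<close>
  have "upper_triangular P"
    using P by (auto simp: upper_triangular_def P_index du intro!: coeff_eq_0)
  moreover have "diag_mat P = replicate N 1"
    using P lu du by (auto simp: diag_mat_def P_index intro!: nth_equalityI)
  ultimately have det: "det P = 1"
    using det_upper_triangular[OF _ P] by simp
  have "P * poly_mat h C = (companion_mat g \<otimes>\<^sub>K 1\<^sub>m m) * P"
  proof (rule eq_matI)
    have K: "companion_mat g \<otimes>\<^sub>K 1\<^sub>m m \<in> carrier_mat N N"
      using kronecker_mat_carrier[OF companion_mat_carrier[of g] one_carrier_mat[of m]]
      by (simp add: N_def n_def)
    show "dim_row (P * poly_mat h C) = dim_row ((companion_mat g \<otimes>\<^sub>K 1\<^sub>m m) * P)"
      "dim_col (P * poly_mat h C) = dim_col ((companion_mat g \<otimes>\<^sub>K 1\<^sub>m m) * P)"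
      using P K poly_mat_carrier[OF C, of h] by auto
    fix k j assume "k < dim_row ((companion_mat g \<otimes>\<^sub>K 1\<^sub>m m) * P)"
      "j < dim_col ((companion_mat g \<otimes>\<^sub>K 1\<^sub>m m) * P)"
    then have k: "k < N" and j: "j < N" using P K by auto
    define a b where "a = k div m" and "b = k mod m"
    have a: "a < n" and b: "b < m" using k m by (auto simp: a_def b_def N_def less_mult_imp_div_less)
    have uk: "u k * h = h ^ (n - a) * monom 1 (m - 1 - b)"
    proof -
      have "n - a = Suc (n - 1 - a)" using a by simp
      then show ?thesis by (simp add: u_def v_def a_def b_def mult_ac)
    qed
    \<comment> \<open>Row \<open>k\<close> of the Kronecker product combines the rows of
      \<open>P\<close> with the same offset \<open>b\<close>, that is, the same power of the
      variable times different powers of \<open>h\<close>.\<close>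
    have "((companion_mat g \<otimes>\<^sub>K 1\<^sub>m m) * P) $$ (k, j)
      = (\<Sum>c<n. companion_mat g $$ (a, c) * P $$ (c * m + b, j))"
      unfolding a_def b_def n_def
      by (rule kronecker_one_mult_index) (use P k j in \<open>auto simp: N_def n_def\<close>)
    also have "\<dots> = (\<Sum>c<n. companion_mat g $$ (a, c) * \<phi> j (v b c))"
      using j b lt by (intro sum.cong) (auto simp: P_def u_def)
    also have "\<dots> = \<phi> j (\<Sum>c<n. smult (companion_mat g $$ (a, c)) (v b c))"
      using j by (simp add: \<phi>_sum \<phi>_smult)
    also have "(\<Sum>c<n. smult (companion_mat g $$ (a, c)) (v b c))
      = (\<Sum>c<n. smult (companion_mat g $$ (a, c)) (h ^ (n - 1 - c))) * monom 1 (m - 1 - b)"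
      by (simp add: v_def sum_distrib_right)
    \<comment> \<open>Only in the block \<open>a = 0\<close> does multiplication by \<open>h\<close>
      lead out of the basis, to the power \<open>h ^ n\<close>. The resulting error is a multiple of
      \<open>G\<close>, and \<open>\<phi>\<close> kills it.\<close>
    also have "\<dots> = u k * h + G * (if a = 0 then - monom 1 (m - 1 - b) else 0)"
      unfolding uk n_def G_def sum_companion_mat_row[OF g a[unfolded n_def]]
      by (simp add: left_diff_distrib)
    also have "\<phi> j \<dots> = \<phi> j (u k * h)" using \<phi>_add[OF j] \<phi>_G[OF j] by simp
    also have "\<dots> = (P * poly_mat h C) $$ (k, j)"
      using k j carrier_matD[OF C]
      by (simp add: \<phi>_mult P_def scalar_prod_def atLeast0LessThan)
    finally show "(P * poly_mat h C) $$ (k, j) = ((companion_mat g \<otimes>\<^sub>K 1\<^sub>m m) * P) $$ (k, j)" ..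
  qed
  with P det show ?thesis using that[of P] by (simp add: N_def n_def m_def C_def G_def)
qed

theorem theorem3p13:
  fixes f g h :: "'a::idom poly"
  assumes "elementary_divisor_domain TYPE('a)"
    and "lead_coeff g = 1" and "degree g > 0"
    and "lead_coeff h = 1" and "degree h > 0"
  shows "poly_mat (f \<circ>\<^sub>p h) (companion_mat (g \<circ>\<^sub>p h))
           \<sim>\<^sub>S poly_mat f (companion_mat g) \<otimes>\<^sub>K 1\<^sub>m (degree h)
       \<and> poly_mat f (companion_mat g) \<otimes>\<^sub>K 1\<^sub>m (degree h)
           \<sim>\<^sub>S 1\<^sub>m (degree h) \<otimes>\<^sub>K poly_mat f (companion_mat g)
       \<and> 1\<^sub>m (degree h) \<otimes>\<^sub>K poly_mat f (companion_mat g)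
           = diag_block_mat (replicate (degree h) (poly_mat f (companion_mat g)))"
proof (intro conjI)
  let ?N = "degree g * degree h" and ?C = "companion_mat (g \<circ>\<^sub>p h)"
  note Cg = companion_mat_carrier[of g]
  have C: "?C \<in> carrier_mat ?N ?N"
    using companion_mat_carrier[of "g \<circ>\<^sub>p h"] by (simp add: degree_pcompose)
  have K: "companion_mat g \<otimes>\<^sub>K 1\<^sub>m (degree h) \<in> carrier_mat ?N ?N" by simp
  obtain P where P: "P \<in> carrier_mat ?N ?N" "det P = 1"
    and PC: "P * poly_mat h ?C = (companion_mat g \<otimes>\<^sub>K 1\<^sub>m (degree h)) * P"
    using companion_mat_pcompose assms by blast
  \<comment> \<open>Applying \<open>f\<close> keeps the intertwiner \<open>P\<close>. The left side
    then involves the composition of \<open>f\<close> with \<open>h\<close>, and on the right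
    \<open>f\<close> passes through the Kronecker product.\<close>
  have "P * poly_mat f (poly_mat h ?C) = poly_mat f (companion_mat g \<otimes>\<^sub>K 1\<^sub>m (degree h)) * P"
    by (rule poly_mat_intertwine[OF poly_mat_carrier[OF C] K P(1) PC])
  then show "poly_mat (f \<circ>\<^sub>p h) ?C \<sim>\<^sub>S poly_mat f (companion_mat g) \<otimes>\<^sub>K 1\<^sub>m (degree h)"
    using unimodular_similarI[OF poly_mat_carrier[OF poly_mat_carrier[OF C]] poly_mat_carrier[OF K] P]
    by (simp add: poly_mat_pcompose[OF C] poly_mat_kronecker_one[OF Cg])
  show "poly_mat f (companion_mat g) \<otimes>\<^sub>K 1\<^sub>m (degree h)
      \<sim>\<^sub>S 1\<^sub>m (degree h) \<otimes>\<^sub>K poly_mat f (companion_mat g)"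
    by (rule kronecker_one_commute[OF poly_mat_carrier[OF Cg]])
  show "1\<^sub>m (degree h) \<otimes>\<^sub>K poly_mat f (companion_mat g)
      = diag_block_mat (replicate (degree h) (poly_mat f (companion_mat g)))"
    by (rule one_kronecker_eq_diag_block_mat[OF poly_mat_carrier[OF Cg]])
qed

end
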